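(* Let $t$ be a nontrivial term, and let $\mathcal{K}$ be the class of all graphs $H$ such that there does not exist any strong homomorphism of $G(t)$ into $H$. Then $\mathcal{K}$ is a graph quasivariety, defined by the implication $\alpha\to\beta$, where $\alpha:=\Sigma(G(t))$ and $\beta:=(L(t)\approx\infty)$; that is, $\mathcal{K}=\operatorname{Mod}\{\alpha\to\beta\}$.
   Context: Graphs. A graph $G=(V,E)$ consists of a set $V=V(G)$ of vertices and a set $E=E(G)\subseteq V\times V$ of (directed) edges; loops are allowed. A strong homomorphism $h\colon G\to G'$ is a map $V(G)\to V(G')$ such that for all $u,v\in V(G)$: $(u,v)\in E(G)$ if and only if $(h(u),h(v))\in E(G')$. Terms and term graphs. Terms are built from variables $X=\{x_1,x_2,\dots\}$ and the constant symbol $\infty$ using one binary operation symbol (juxtaposition). A term is trivial if $\infty$ occurs in it, and nontrivial otherwise. $L(t)$ is the leftmost variable occurring in a nontrivial term $t$, and $\operatorname{var}(t)$ the set of its variables. For a nontrivial term $t$, the graph $G(t)$ has vertex set $\operatorname{var}(t)$ and edge set $E(t)$ defined by $E(x)=\emptyset$ for a variable $x$, and $E(t_1t_2)=E(t_1)\cup E(t_2)\cup\{(L(t_1),L(t_2))\}$. Encoding. For a nontrivial term $t$ (the vertices of $G(t)$ being variables), $\Sigma(G(t)):=\{xy\approx x\mid (x,y)\in E(t)\}\cup\{xy\approx\infty\mid x,y\in\operatorname{var}(t),\ (x,y)\notin E(t)\}$. Graph algebras and implications. For a graph $H$ and an element $\infty\notin V(H)$, the graph algebra $\mathbb{A}(H)$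 has universe $V(H)\cup\{\infty\}$, the constant $\infty$, and the binary operation $x\cdot y:=x$ if $(x,y)\in E(H)$ and $x\cdot y:=\infty$ otherwise. An identity is a pair $s\approx t$ of terms. An implication $\alpha\to\beta$ consists of a finite set $\alpha$ of identities and an identity $\beta=(s\approx t)$. An assignment is a map $h\colon X\to V(H)\cup\{\infty\}$, extended to all terms by evaluation in $\mathbb{A}(H)$. $H\models\alpha\to\beta$ means: for every assignment $h$, if $h(s_i)=h(t_i)$ for all $s_i\approx t_i\in\alpha$, then $h(s)=h(t)$. For a set $\Sigma$ of implications, $\operatorname{Mod}\Sigma$ is the class of all graphs satisfying every member of $\Sigma$. A class $\mathcal{K}$ of graphs is a graph quasivariety if $\mathcal{K}=\operatorname{Mod}\Sigma$ for some set $\Sigma$ of implications. *)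

theory Defs
  imports "Graph_Theory.Pair_Digraph"
begin

text \<open>
  A graph is a pair digraph (a vertex set and a set of ordered pairs) satisfying
  \<^locale>\<open>pair_wf_digraph\<close>, i.e. all edges join vertices. Loops, infinite graphs and the
  empty graph are allowed.
\<close>

definition strong_hom ::
    "('a \<Rightarrow> 'b) \<Rightarrow> 'a pair_pre_digraph \<Rightarrow> 'b pair_pre_digraph \<Rightarrow> bool" where
  "strong_hom h G H \<longleftrightarrow>
     h ` pverts G \<subseteq> pverts H \<and>
     (\<forall>u\<in>pverts G. \<forall>v\<in>pverts G. (u, v) \<in> parcs G \<longleftrightarrow> (h u, h v) \<in> parcs H)"

datatype trm = Var nat | Infty | App trm trm

type_synonym ident = "trm \<times> trm"

type_synonym impl = "ident set \<times> ident"

primrec nontrivial :: "trm \<Rightarrow> bool" where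
  "nontrivial (Var x) \<longleftrightarrow> True"
| "nontrivial Infty \<longleftrightarrow> False"
| "nontrivial (App s t) \<longleftrightarrow> nontrivial s \<and> nontrivial t"

primrec trm_vars :: "trm \<Rightarrow> nat set" where
  "trm_vars (Var x) = {x}"
| "trm_vars Infty = {}"
| "trm_vars (App s t) = trm_vars s \<union> trm_vars t"

text \<open>
  The next three functions are meant for nontrivial terms only; their values on
  \<^const>\<open>Infty\<close> are irrelevant.
\<close>

primrec leftmost :: "trm \<Rightarrow> nat" where
  "leftmost (Var x) = x"
| "leftmost Infty = undefined"
| "leftmost (App s t) = leftmost s"

primrec trm_edges :: "trm \<Rightarrow> (nat \<times> nat) set" where
  "trm_edges (Var x) = {}"
| "trm_edges Infty = {}"
| "trm_edges (App s t) = trm_edges s \<union> trm_edges t \<union> {(leftmost s, leftmost t)}"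

definition trm_graph :: "trm \<Rightarrow> nat pair_pre_digraph" where
  "trm_graph t = \<lparr> pverts = trm_vars t, parcs = trm_edges t \<rparr>"

lemma leftmost_in_trm_vars: "nontrivial t \<Longrightarrow> leftmost t \<in> trm_vars t"
  by (induction t) auto

lemma trm_edges_subset: "nontrivial t \<Longrightarrow> trm_edges t \<subseteq> trm_vars t \<times> trm_vars t"
  by (induction t) (auto simp: leftmost_in_trm_vars)

lemma pair_wf_digraph_trm_graph: "nontrivial t \<Longrightarrow> pair_wf_digraph (trm_graph t)"
  using trm_edges_subset by (fastforce simp: pair_wf_digraph_def trm_graph_def)

definition graph_idents :: "nat pair_pre_digraph \<Rightarrow> ident set" where
  "graph_idents G =
     {(App (Var x) (Var y), Var x) | x y. (x, y) \<in> parcs G} \<union>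
     {(App (Var x) (Var y), Infty) | x y. x \<in> pverts G \<and> y \<in> pverts G \<and> (x, y) \<notin> parcs G}"

text \<open>
  The element \<open>\<infinity>\<close> outside the vertex set is \<^const>\<open>None\<close>, so that it is
  available even when the vertices exhaust their type.
\<close>

definition galg_carrier :: "'a pair_pre_digraph \<Rightarrow> 'a option set" where
  "galg_carrier H = insert None (Some ` pverts H)"

fun galg_mult :: "'a pair_pre_digraph \<Rightarrow> 'a option \<Rightarrow> 'a option \<Rightarrow> 'a option" where
  "galg_mult H (Some u) (Some v) = (if (u, v) \<in> parcs H then Some u else None)"
| "galg_mult H _ _ = None"

primrec galg_eval :: "'a pair_pre_digraph \<Rightarrow> (nat \<Rightarrow> 'a option) \<Rightarrow> trm \<Rightarrow> 'a option" where
  "galg_eval H h (Var x) = h x"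
| "galg_eval H h Infty = None"
| "galg_eval H h (App s t) = galg_mult H (galg_eval H h s) (galg_eval H h t)"

definition satisfies_impl :: "'a pair_pre_digraph \<Rightarrow> impl \<Rightarrow> bool" where
  "satisfies_impl H \<phi> \<longleftrightarrow>
     (\<forall>h. range h \<subseteq> galg_carrier H \<longrightarrow>
        (\<forall>(p, q)\<in>fst \<phi>. galg_eval H h p = galg_eval H h q) \<longrightarrow>
        galg_eval H h (fst (snd \<phi>)) = galg_eval H h (snd (snd \<phi>)))"

definition is_implication :: "impl \<Rightarrow> bool" where
  "is_implication \<phi> \<longleftrightarrow> finite (fst \<phi>)"

definition Mod_graphs :: "impl set \<Rightarrow> 'a pair_pre_digraph set" where
  "Mod_graphs \<Sigma> = {H. pair_wf_digraph H \<and> (\<forall>\<phi>\<in>\<Sigma>. satisfies_impl H \<phi>)}"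

text \<open>Classes of graphs are rendered as sets of graphs over an arbitrary type of vertices.\<close>

definition graph_quasivariety :: "'a pair_pre_digraph set \<Rightarrow> bool" where
  "graph_quasivariety K \<longleftrightarrow> (\<exists>\<Sigma>. (\<forall>\<phi>\<in>\<Sigma>. is_implication \<phi>) \<and> K = Mod_graphs \<Sigma>)"

end

theory Submission
  imports Defs
begin

text \<open>
  If \<open>xy \<approx> x\<close> holds under an assignment that does not send \<open>x\<close> to \<open>\<infinity>\<close>, then it does
  not send \<open>y\<close> to \<open>\<infinity>\<close> either. Every vertex of \<open>G(t)\<close> is reachable from \<open>L(t)\<close>, so an
  assignment satisfying \<open>\<Sigma>(G(t))\<close> and not sending \<open>L(t)\<close> to \<open>\<infinity>\<close> maps all vertices of
  \<open>G(t)\<close> into \<open>V(H)\<close>, and there \<open>\<Sigma>(G(t))\<close> says exactly that it is a strong homomorphism.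
\<close>

lemma finite_trm_vars: "finite (trm_vars t)"
  by (induction t) auto

text \<open>An implication may have only finitely many premises. Every identity here arises from a
  pair of vertices by one of two maps.\<close>

lemma finite_graph_idents:
  assumes "finite (pverts G)" "parcs G \<subseteq> pverts G \<times> pverts G"
  shows "finite (graph_idents G)"
proof (rule finite_subset)
  show "graph_idents G \<subseteq> (\<lambda>(x, y). (App (Var x) (Var y), Var x)) ` (pverts G \<times> pverts G) \<union>
      (\<lambda>(x, y). (App (Var x) (Var y), Infty)) ` (pverts G \<times> pverts G)"
    using assms(2) unfolding graph_idents_def by auto
qed (use assms(1) in simp)

text \<open>A product has the same leftmost variable as its left factor, so paths inside
  \<open>s\<close> persist. The right factor is entered through the new edge from
  \<open>leftmost s\<close> to \<open>leftmost t\<close>.\<close>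

lemma trm_vars_reachable_from_leftmost:
  assumes "nontrivial t" "x \<in> trm_vars t"
  shows "(leftmost t, x) \<in> (trm_edges t)\<^sup>*"
  using assms
proof (induction t)
  case (App s t)
  have mono: "(trm_edges s)\<^sup>* \<subseteq> (trm_edges (App s t))\<^sup>*"
    "(trm_edges t)\<^sup>* \<subseteq> (trm_edges (App s t))\<^sup>*"
    by (intro rtrancl_mono; auto)+
  show ?case
  proof (cases "x \<in> trm_vars s")
    case True
    then show ?thesis using App mono(1) by auto
  next
    case False
    then have "(leftmost t, x) \<in> (trm_edges (App s t))\<^sup>*"
      using App mono(2) by auto
    then show ?thesis
      by (rule converse_rtrancl_into_rtrancl[rotated]) simp
  qed
qed auto

lemma galg_mult_eq_left_Some_iff:
  "galg_mult H (Some u) b = Some u \<longleftrightarrow> (\<exists>v. b = Some v \<and> (u, v) \<in> parcs H)"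
  by (cases b) auto

lemma strong_hom_if_satisfies_graph_idents:
  assumes "nontrivial t"
    and carrier: "range h \<subseteq> galg_carrier H"
    and sat: "\<And>p q. (p, q) \<in> graph_idents (trm_graph t) \<Longrightarrow> galg_eval H h p = galg_eval H h q"
    and nz: "h (leftmost t) \<noteq> None"
  shows "strong_hom (the \<circ> h) (trm_graph t) H"
proof -
  have edge: "galg_mult H (h x) (h y) = h x" if "(x, y) \<in> trm_edges t" for x y
    using sat[of "App (Var x) (Var y)" "Var x"] that by (auto simp: graph_idents_def trm_graph_def)
  have nonedge: "galg_mult H (h x) (h y) = None"
    if "x \<in> trm_vars t" "y \<in> trm_vars t" "(x, y) \<notin> trm_edges t" for x y
    using sat[of "App (Var x) (Var y)" Infty] that by (auto simp: graph_idents_def trm_graph_def)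
  have not_None: "h x \<noteq> None" if "x \<in> trm_vars t" for x
    using trm_vars_reachable_from_leftmost[OF assms(1) that]
  proof (induction rule: rtrancl_induct)
    case base
    show ?case by (rule nz)
  next
    case (step y z)
    then show ?case using edge[of y z] by (auto simp: galg_mult_eq_left_Some_iff)
  qed
  have "the (h x) \<in> pverts H" if "x \<in> trm_vars t" for x
  proof -
    have "h x \<in> galg_carrier H" using carrier by blast
    then show ?thesis using not_None[OF that] by (auto simp: galg_carrier_def)
  qed
  \<comment> \<open>Two proper elements multiply to the left one if they form an edge of
    \<open>H\<close> and to \<open>None\<close> otherwise. Hence the identity belonging to the pair
    \<open>(x, y)\<close> decides whether its image is an edge.\<close>
  moreover have "(x, y) \<in> trm_edges t \<longleftrightarrow> (the (h x), the (h y)) \<in> parcs H"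
    if "x \<in> trm_vars t" "y \<in> trm_vars t" for x y
    using not_None[OF that(1)] not_None[OF that(2)] edge[of x y] nonedge[OF that]
    by (cases "(x, y) \<in> trm_edges t") (auto split: if_splits)
  ultimately show ?thesis
    by (auto simp: strong_hom_def trm_graph_def)
qed

text \<open>All variables in these identities are vertices of \<open>G\<close>, since edges join
  vertices. So \<open>k\<close> takes only proper values on them, and each product is determined by
  \<open>h\<close> preserving and reflecting edges.\<close>

lemma satisfies_graph_idents_if_strong_hom:
  assumes "parcs G \<subseteq> pverts G \<times> pverts G" "strong_hom h G H"
    and "(p, q) \<in> graph_idents G"
  defines "k \<equiv> \<lambda>x. if x \<in> pverts G then Some (h x) else None"
  shows "galg_eval H k p = galg_eval H k q"
  using assms by (auto simp: graph_idents_def strong_hom_def)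

text \<open>Strong homomorphisms yield, and are yielded by, assignments that satisfy all premises
  but violate the conclusion.\<close>

lemma satisfies_impl_iff_no_strong_hom:
  fixes H :: "'a pair_pre_digraph"
  assumes "nontrivial t"
  shows "satisfies_impl H (graph_idents (trm_graph t), (Var (leftmost t), Infty)) \<longleftrightarrow>
    \<not> (\<exists>h. strong_hom h (trm_graph t) H)"
proof
  assume L: "satisfies_impl H (graph_idents (trm_graph t), (Var (leftmost t), Infty))"
  show "\<not> (\<exists>h. strong_hom h (trm_graph t) H)"
  proof
    assume "\<exists>h. strong_hom h (trm_graph t) H"
    then obtain h where h: "strong_hom h (trm_graph t) H" ..
    \<comment> \<open>Off the vertices \<open>h\<close> is unconstrained and may leave
      \<open>pverts H\<close>. The value \<open>None\<close> there keeps \<open>k\<close> inside the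
      carrier.\<close>
    define k where "k = (\<lambda>x. if x \<in> pverts (trm_graph t) then Some (h x) else None)"
    have "parcs (trm_graph t) \<subseteq> pverts (trm_graph t) \<times> pverts (trm_graph t)"
      using trm_edges_subset[OF assms] by (simp add: trm_graph_def)
    then have "\<forall>(p, q)\<in>graph_idents (trm_graph t). galg_eval H k p = galg_eval H k q"
      using satisfies_graph_idents_if_strong_hom[OF _ h] unfolding k_def by blast
    moreover have "range k \<subseteq> galg_carrier H"
      using h by (auto simp: k_def galg_carrier_def strong_hom_def)
    ultimately have "k (leftmost t) = None"
      using L by (simp add: satisfies_impl_def)
    then show False
      using leftmost_in_trm_vars[OF assms] by (simp add: k_def trm_graph_def)
  qed
next
  assume R: "\<not> (\<exists>h. strong_hom h (trm_graph t) H)"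
  have "k (leftmost t) = None" if "range k \<subseteq> galg_carrier H"
    "\<forall>(p, q)\<in>graph_idents (trm_graph t). galg_eval H k p = galg_eval H k q" for k
  proof (rule ccontr)
    assume "k (leftmost t) \<noteq> None"
    then have "strong_hom (the \<circ> k) (trm_graph t) H"
      using that by (intro strong_hom_if_satisfies_graph_idents[OF assms]) blast+
    with R show False by blast
  qed
  then show "satisfies_impl H (graph_idents (trm_graph t), (Var (leftmost t), Infty))"
    by (simp add: satisfies_impl_def)
qed

theorem proposition5p7:
  fixes t :: trm
    and K :: "'a pair_pre_digraph set"
    and \<alpha> :: "ident set"
    and \<beta> :: ident
  assumes "nontrivial t"
    and "K = {H. pair_wf_digraph H \<and> \<not> (\<exists>h. strong_hom h (trm_graph t) H)}"
    and "\<alpha> = graph_idents (trm_graph t)"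
    and "\<beta> = (Var (leftmost t), Infty)"
  shows "graph_quasivariety K \<and> is_implication (\<alpha>, \<beta>) \<and> K = Mod_graphs {(\<alpha>, \<beta>)}"
proof -
  have impl: "is_implication (\<alpha>, \<beta>)"
    using finite_graph_idents[of "trm_graph t"] finite_trm_vars trm_edges_subset[OF assms(1)]
    by (simp add: is_implication_def assms(3) trm_graph_def)
  have Mod: "K = Mod_graphs {(\<alpha>, \<beta>)}"
    by (simp add: Mod_graphs_def assms(2-4) satisfies_impl_iff_no_strong_hom[OF assms(1)])
  have "graph_quasivariety K"
    unfolding graph_quasivariety_def using impl Mod by (intro exI[of _ "{(\<alpha>, \<beta>)}"]) simp
  with impl Mod show ?thesis by blast
qed

end
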